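(* Let $G$ be a graph on $n \geq 3$ vertices such that $G$ and its complement $\overline{G}$ are both connected. Then $$b_{\rm g}'(G)\, b_{\rm g}'(\overline{G}) \leq n+21.$$
   Context: All graphs are finite, simple and undirected. The burning game on a graph $G$ is played by two players, Burner and Staller, in rounds $t=1,2,3,\dots$. Initially (round $0$) all vertices are unburned. Each round $t\ge 1$ consists of two phases: first, in the spreading phase, every unburned vertex having a burning neighbor starts to burn (fire spreads simultaneously, by distance one, from all burning vertices); then, in the selection phase, if unburned vertices remain, the player whose turn it is chooses one unburned vertex, which starts to burn. Burning vertices stay burning forever. The players alternate: one of them selects in the odd rounds, the other in the even rounds. The game ends in the first round in which all vertices of $G$ are burning (possibly already after the spreading phase of that round). Burner wants to minimize the number of rounds and Staller wants to maximize it. If both play optimally, the number of rounds is denoted $b_{\rm g}'(G)$ (the Staller-start game burning number) when Staller makes the first move (selects in round 1). *)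

theory Defs
  imports "Graph_Theory.Graph_Theory"
begin

definition complement :: "'a pair_pre_digraph \<Rightarrow> 'a pair_pre_digraph" where
  "complement G = \<lparr> pverts = pverts G,
     parcs = {(u, v). u \<in> pverts G \<and> v \<in> pverts G \<and> u \<noteq> v \<and> (u, v) \<notin> parcs G} \<rparr>"

lemma pair_graph_complement:
  assumes "pair_graph G"
  shows "pair_graph (complement G)"
proof -
  interpret pair_graph G by fact
  have "parcs (complement G) \<subseteq> pverts G \<times> pverts G"
    by (auto simp: complement_def)
  then have "finite (parcs (complement G))"
    using pair_finite_verts by (meson finite_SigmaI finite_subset)
  moreover have "sym (parcs G)"
    using pair_sym_arcs by (simp add: symmetric_def)
  then have "symmetric (complement G)"
    unfolding symmetric_def with_proj_simps by (auto simp: complement_def intro!: symI dest: symD)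
  ultimately show ?thesis
    using pair_finite_verts by unfold_locales (auto simp: complement_def)
qed

datatype player = Burner | Staller

fun opponent :: "player \<Rightarrow> player" where
  "opponent Burner = Staller"
| "opponent Staller = Burner"

fun best :: "player \<Rightarrow> nat set \<Rightarrow> nat" where
  "best Burner = Min"
| "best Staller = Max"

definition spread :: "'a pair_pre_digraph \<Rightarrow> 'a set \<Rightarrow> 'a set" where
  "spread G B = B \<union> {v \<in> pverts G. \<exists>u \<in> B. (u, v) \<in> parcs G}"

text \<open>
  The minimax number of further rounds when the vertices in \<open>B\<close> are burning and \<open>p\<close> selects in
  the next round. A round that completes the burning counts, whether its spreading or its
  selection phase does so. The value 0 for infinite graphs only makes the recursion terminate.
\<close>

function rounds_left :: "'a pair_pre_digraph \<Rightarrow> player \<Rightarrow> 'a set \<Rightarrow> nat" where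
  "rounds_left G p B =
    (if infinite (pverts G) \<or> pverts G \<subseteq> B then 0
     else if pverts G \<subseteq> spread G B then 1
     else 1 + best p ((\<lambda>v. rounds_left G (opponent p) (insert v (spread G B)))
                        ` (pverts G - spread G B)))"
  by pat_completeness auto
termination
proof (relation "measure (\<lambda>(G, p, B). card (pverts G - B))", goal_cases)
  case (2 G p B v)
  then have "pverts G - insert v (spread G B) \<subset> pverts G - B" "finite (pverts G - B)"
    by (auto simp: spread_def)
  then show ?case
    by (simp add: psubset_card_mono)
qed simp

declare rounds_left.simps [simp del]

definition staller_start_game_burning_number :: "'a pair_pre_digraph \<Rightarrow> nat" where
  "staller_start_game_burning_number G = rounds_left G Staller {}"

end

theory Submission
  imports Defs
begin

text \<open>
  Burner can follow a covering of the graph by \<open>k\<close> balls of radii \<open>0, 2, \<dots>, 2k - 2\<close>: the centre of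
  the ball of radius \<open>2j\<close> is selected when \<open>2j\<close> rounds remain, so the game lasts at most \<open>2k\<close>
  rounds. Cutting off subtrees below an ancestor of a deepest vertex of a breadth-first tree shows
  that a connected graph on at most \<open>k\<^sup>2\<close> vertices has such a covering, as the ball of radius \<open>2j\<close>
  takes away at least \<open>2j + 1\<close> vertices and \<open>1 + 3 + \<dots> + (2k - 1) = k\<^sup>2\<close>.
  On the other hand, the game lasts at most one round more than the diameter. If \<open>G\<close> and its
  complement both have diameter at most \<open>3\<close>, the product is at most \<open>16\<close>. Otherwise one of them
  has diameter at least \<open>4\<close>, hence the other one has diameter at most \<open>2\<close>, and the product is at
  most \<open>6k\<close> with \<open>k = \<lceil>\<surd>n\<rceil>\<close>; this suffices because \<open>(k - 1)\<^sup>2 < n\<close>.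
\<close>

section \<open>Balls\<close>

lemma spread_mono: "A \<subseteq> B \<Longrightarrow> spread G A \<subseteq> spread G B"
  by (auto simp: spread_def)

lemma subset_spread: "B \<subseteq> spread G B"
  by (auto simp: spread_def)

lemma spread_pow_mono: "A \<subseteq> B \<Longrightarrow> (spread G ^^ m) A \<subseteq> (spread G ^^ m) B"
  by (induction m) (auto dest: spread_mono)

lemma subset_spread_pow: "B \<subseteq> (spread G ^^ m) B"
  by (induction m) (use subset_spread in fastforce)+

lemma spread_pow_le: "m \<le> n \<Longrightarrow> (spread G ^^ m) B \<subseteq> (spread G ^^ n) B"
  by (metis funpow_add le_add_diff_inverse2 comp_apply subset_spread_pow)

section \<open>Upper bounds for the game\<close>

lemma best_le: "finite A \<Longrightarrow> A \<noteq> {} \<Longrightarrow> (\<And>a. a \<in> A \<Longrightarrow> a \<le> (m::nat)) \<Longrightarrow> best p A \<le> m"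
  by (cases p) (auto intro: Min.coboundedI le_trans[OF Min_le])

lemma rounds_left_le_Suc:
  assumes "\<And>v. v \<in> pverts G - spread G B
      \<Longrightarrow> rounds_left G (opponent p) (insert v (spread G B)) \<le> m"
  shows "rounds_left G p B \<le> Suc m"
  using assms by (subst rounds_left.simps) (auto intro!: best_le)

text \<open>Selections only enlarge the fire, so spreading alone finishes in time, whoever
  moves.\<close>

lemma rounds_left_le_spread_pow:
  assumes "pverts G \<subseteq> (spread G ^^ m) B"
  shows "rounds_left G p B \<le> m"
  using assms
proof (induction m arbitrary: p B)
  case 0
  then show ?case by (subst rounds_left.simps) simp
next
  case (Suc m)
  show ?case
  proof (rule rounds_left_le_Suc)
    fix v
    have "pverts G \<subseteq> (spread G ^^ m) (spread G B)"
      using Suc.prems by (simp add: funpow_swap1)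
    also have "\<dots> \<subseteq> (spread G ^^ m) (insert v (spread G B))"
      by (intro spread_pow_mono) blast
    finally show "rounds_left G (opponent p) (insert v (spread G B)) \<le> m"
      by (rule Suc.IH)
  qed
qed

text \<open>Nothing spreads in round 1, so that round only places Staller's vertex.\<close>

lemma staller_start_game_burning_number_le_Suc:
  assumes "\<And>v. v \<in> pverts G \<Longrightarrow> pverts G \<subseteq> (spread G ^^ m) {v}"
  shows "staller_start_game_burning_number G \<le> Suc m"
  unfolding staller_start_game_burning_number_def
proof (rule rounds_left_le_Suc)
  fix v assume "v \<in> pverts G - spread G {}"
  then have "pverts G \<subseteq> (spread G ^^ m) {v}"
    using assms by blast
  also have "\<dots> \<subseteq> (spread G ^^ m) (insert v (spread G {}))"
    by (intro spread_pow_mono) blast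
  finally show "rounds_left G (opponent Staller) (insert v (spread G {})) \<le> m"
    by (rule rounds_left_le_spread_pow)
qed

lemma rounds_left_Burner_le_Suc:
  assumes "v \<in> pverts G - spread G B"
    and "rounds_left G Staller (insert v (spread G B)) \<le> m"
  shows "rounds_left G Burner B \<le> Suc m"
  using assms by (subst rounds_left.simps) (auto intro: le_trans[OF Min_le])

text \<open>Centres stand in the order in which Burner selects them; each radius is the number of
  rounds left after that selection, two per remaining centre.\<close>

fun covered :: "'a pair_pre_digraph \<Rightarrow> 'a list \<Rightarrow> 'a set" where
  "covered G [] = {}"
| "covered G (c # cs) = (spread G ^^ (2 * length cs)) {c} \<union> covered G cs"

text \<open>If fire has already reached the centre \<open>c\<close> that Burner wants to select, any other choice is
  at least as good.\<close>

lemma rounds_left_Staller_le_covered: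
  assumes "pverts G \<subseteq> (spread G ^^ (2 * length cs)) B \<union> covered G cs" and "set cs \<subseteq> pverts G"
  shows "rounds_left G Staller B \<le> 2 * length cs"
  using assms
proof (induction cs arbitrary: B)
  case Nil
  then show ?case by (subst rounds_left.simps) simp
next
  case (Cons c cs)
  let ?m = "2 * length cs"
  have "rounds_left G Staller B \<le> Suc (Suc ?m)"
  proof (rule rounds_left_le_Suc)
    fix u
    define C where "C = insert u (spread G B)"
    have "rounds_left G Burner C \<le> Suc ?m"
    proof (cases "pverts G \<subseteq> spread G C")
      case True
      then show ?thesis by (subst rounds_left.simps) simp
    next
      case False
      then obtain w where w: "w \<in> pverts G - spread G C" "c \<in> insert w (spread G C)"
        using Cons.prems(2) by (cases "c \<in> spread G C") auto
      \<comment> \<open>A Staller-Burner pair of rounds has two spreading phases, so the radius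
        around \<open>B\<close> may drop by two.\<close>
      have "spread G (spread G B) \<subseteq> insert w (spread G C)"
        using spread_mono[of "spread G B" C G] by (auto simp: C_def)
      then have "(spread G ^^ ?m) (spread G (spread G B)) \<subseteq> (spread G ^^ ?m) (insert w (spread G C))"
        by (rule spread_pow_mono)
      moreover have "(spread G ^^ (2 * length (c # cs))) B = (spread G ^^ ?m) (spread G (spread G B))"
        by (simp add: funpow_swap1)
      moreover have "(spread G ^^ ?m) {c} \<subseteq> (spread G ^^ ?m) (insert w (spread G C))"
        using w(2) by (intro spread_pow_mono) simp
      ultimately have "pverts G \<subseteq> (spread G ^^ ?m) (insert w (spread G C)) \<union> covered G cs"
        using Cons.prems(1) by auto
      then have "rounds_left G Staller (insert w (spread G C)) \<le> ?m"
        using Cons.prems(2) by (intro Cons.IH) auto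
      with w(1) show ?thesis by (rule rounds_left_Burner_le_Suc)
    qed
    then show "rounds_left G (opponent Staller) (insert u (spread G B)) \<le> Suc ?m"
      by (simp add: C_def)
  qed
  then show ?case by simp
qed

section \<open>Covering a connected graph by balls\<close>

text \<open>Connectedness refers to the symmetric closure; as the arcs are symmetric already, it
  yields directed walks, along which fire travels.\<close>

lemma connected_spread_pow:
  assumes "pair_graph G" and "Digraph_Component.connected (with_proj G)"
    and "u \<in> pverts G" and "v \<in> pverts G"
  shows "\<exists>m. v \<in> (spread G ^^ m) {u}"
proof -
  interpret pair_graph G by fact
  have "strongly_connected (with_proj G)"
    using assms(2) by (intro symmetric_connected_imp_strongly_connected sym_arcs)
  then have "u \<rightarrow>\<^sup>*\<^bsub>with_proj G\<^esub> v"
    using assms(3,4) by (auto simp: strongly_connected_def)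
  then show ?thesis
  proof (induction rule: reachable_induct)
    case base
    show ?case by (rule exI[of _ 0]) simp
  next
    case (step x y)
    then obtain m where "x \<in> (spread G ^^ m) {u}" by blast
    then have "y \<in> (spread G ^^ Suc m) {u}"
      using step.hyps arc_snd_in_verts[of "(x, y)"] by (auto simp: spread_def)
    then show ?case by blast
  qed
qed

text \<open>Take for \<open>d v\<close> the time at which fire from \<open>r\<close> first reaches
  \<open>v\<close>; a neighbour igniting \<open>v\<close> lies exactly one layer earlier and serves
  as \<open>par v\<close>.\<close>

lemma breadth_first_tree:
  assumes "\<And>v. v \<in> pverts G \<Longrightarrow> \<exists>m. v \<in> (spread G ^^ m) {r}" and "r \<in> pverts G"
  shows "\<exists>(d :: 'a \<Rightarrow> nat) par. d r = 0 \<and> (\<forall>v \<in> pverts G. v \<noteq> r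
    \<longrightarrow> par v \<in> pverts G \<and> (par v, v) \<in> parcs G \<and> d v = Suc (d (par v)))"
proof -
  define d where "d v = (LEAST m. v \<in> (spread G ^^ m) {r})" for v
  have d_in: "v \<in> (spread G ^^ d v) {r}" if "v \<in> pverts G" for v
    using assms(1)[OF that] unfolding d_def by (rule LeastI_ex)
  have d_le: "d v \<le> m" if "v \<in> (spread G ^^ m) {r}" for v m
    using that unfolding d_def by (rule Least_le)
  have sub: "(spread G ^^ m) {r} \<subseteq> pverts G" for m
    using assms(2) by (induction m) (auto simp: spread_def)
  have d0: "d r = 0"
    using d_le[of r 0] by simp
  have "\<exists>u. u \<in> pverts G \<and> (u, v) \<in> parcs G \<and> d v = Suc (d u)" if v: "v \<in> pverts G" "v \<noteq> r" for v
  proof -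
    obtain m where m: "d v = Suc m"
      using d_in[OF v(1)] v(2) by (cases "d v") auto
    have "v \<notin> (spread G ^^ m) {r}"
      using d_le[of v m] m by auto
    moreover have "v \<in> spread G ((spread G ^^ m) {r})"
      using d_in[OF v(1)] m by simp
    ultimately obtain u where u: "u \<in> (spread G ^^ m) {r}" "(u, v) \<in> parcs G"
      by (auto simp: spread_def)
    then have "u \<in> pverts G" "d u \<le> m"
      using sub d_le by auto
    moreover have "v \<in> (spread G ^^ Suc (d u)) {r}"
      using d_in[OF \<open>u \<in> pverts G\<close>] u(2) v(1) by (auto simp: spread_def)
    then have "d v \<le> Suc (d u)"
      by (rule d_le)
    ultimately show ?thesis
      using u(2) m by auto
  qed
  then obtain par where "\<And>v. v \<in> pverts G \<Longrightarrow> v \<noteq> r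
      \<Longrightarrow> par v \<in> pverts G \<and> (par v, v) \<in> parcs G \<and> d v = Suc (d (par v))"
    by metis
  with d0 show ?thesis by blast
qed

text \<open>Here \<open>S\<close> is what remains of the tree after cutting off subtrees.\<close>

lemma covered_tree:
  assumes "finite S" "S \<subseteq> pverts G" "r \<in> pverts G" "d r = (0::nat)"
    and "\<And>v. v \<in> S \<Longrightarrow> v \<noteq> r \<Longrightarrow> par v \<in> S \<and> (par v, v) \<in> parcs G \<and> d v = Suc (d (par v))"
    and "card S \<le> k\<^sup>2"
  shows "\<exists>cs. length cs = k \<and> set cs \<subseteq> pverts G \<and> S \<subseteq> covered G cs"
  using assms(1,2,5,6)
proof (induction k arbitrary: S)
  case 0
  then show ?case by auto
next
  case (Suc k)
  note tree = Suc.prems(3) and S_verts = Suc.prems(2)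
  have climb: "(par ^^ i) x \<in> S \<and> d ((par ^^ i) x) + i = d x \<and> x \<in> (spread G ^^ i) {(par ^^ i) x}"
    if "x \<in> S" "i \<le> d x" for x i
    using that(2)
  proof (induction i)
    case 0
    then show ?case using that by simp
  next
    case (Suc i)
    let ?y = "(par ^^ i) x"
    have IH: "?y \<in> S" "d ?y + i = d x" "x \<in> (spread G ^^ i) {?y}"
      using Suc by auto
    then have "?y \<noteq> r"
      using Suc.prems assms(4) by auto
    then have y: "par ?y \<in> S" "(par ?y, ?y) \<in> parcs G" "d ?y = Suc (d (par ?y))"
      using IH(1) tree by auto
    then have "{?y} \<subseteq> spread G {par ?y}"
      using IH(1) S_verts by (auto simp: spread_def)
    then have "x \<in> (spread G ^^ i) (spread G {par ?y})"
      using IH(3) spread_pow_mono by blast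
    then show ?case
      using y IH by (simp add: funpow_swap1)
  qed
  show ?case
  proof (cases "S = {}")
    case True
    then show ?thesis
      using assms(3) by (intro exI[of _ "replicate (Suc k) r"]) auto
  next
    case False
    have "Max (d ` S) \<in> d ` S"
      using \<open>finite S\<close> False by (intro Max_in) auto
    then obtain v where "v \<in> S" "d v = Max (d ` S)"
      by (metis imageE)
    with \<open>finite S\<close> have v: "v \<in> S" "\<And>x. x \<in> S \<Longrightarrow> d x \<le> d v"
      by auto
    show ?thesis
    proof (cases "d v \<le> 2 * k")
      case True
      \<comment> \<open>The ascent from \<open>x\<close> ends at depth 0, hence at \<open>r\<close>.
        So the ball around \<open>r\<close> covers \<open>S\<close>, and the other centres only pad
        the list.\<close>
      have "x \<in> (spread G ^^ (2 * k)) {r}" if "x \<in> S" for x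
      proof -
        have "d ((par ^^ d x) x) = 0" "(par ^^ d x) x \<in> S" "x \<in> (spread G ^^ d x) {(par ^^ d x) x}"
          using climb[OF that, of "d x"] by auto
        then have "x \<in> (spread G ^^ d x) {r}"
          using Suc.prems(3)[of "(par ^^ d x) x"] by fastforce
        moreover have "d x \<le> 2 * k"
          using v(2)[OF that] True by simp
        ultimately show ?thesis
          using spread_pow_le[of "d x" "2 * k" G "{r}"] by auto
      qed
      then show ?thesis
        using assms(3) by (intro exI[of _ "r # replicate k r"]) auto
    next
      case False
      \<comment> \<open>\<open>c\<close> lies \<open>2 * k\<close> levels above the deepest vertex
        \<open>v\<close>, and \<open>D\<close> is its subtree. The bound \<open>i \<le> d x\<close>
        stops the ascent at the root, where \<open>par\<close> is arbitrary.\<close>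
      define c where "c = (par ^^ (2 * k)) v"
      define D where "D = {x \<in> S. \<exists>i \<le> d x. (par ^^ i) x = c}"
      have c: "c \<in> S" "d c + 2 * k = d v"
        using climb[OF v(1), of "2 * k"] False by (auto simp: c_def)
      have D_ball: "D \<subseteq> (spread G ^^ (2 * k)) {c}"
      proof
        fix x assume "x \<in> D"
        then obtain i where i: "x \<in> S" "i \<le> d x" "(par ^^ i) x = c"
          by (auto simp: D_def)
        have "d c + i = d x" "x \<in> (spread G ^^ i) {c}"
          using climb[OF i(1,2)] i(3) by auto
        moreover from this have "i \<le> 2 * k"
          using v(2)[OF i(1)] c(2) by simp
        ultimately show "x \<in> (spread G ^^ (2 * k)) {c}"
          using spread_pow_le[of i "2 * k" G "{c}"] by auto
      qed
      have path: "(par ^^ i) v \<in> D" if "i \<le> 2 * k" for i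
      proof -
        have "(par ^^ (2 * k - i)) ((par ^^ i) v) = c"
          using that by (simp add: c_def flip: comp_apply[of "par ^^ _" "par ^^ _"] funpow_add)
        then show ?thesis
          using climb[OF v(1), of i] that False by (auto simp: D_def intro!: exI[of _ "2 * k - i"])
      qed
      \<comment> \<open>Depth separates the \<open>2 * k + 1\<close> vertices on the path from
        \<open>v\<close> up to \<open>c\<close>, and
        \<open>(k + 1)\<^sup>2 - (2 * k + 1) = k\<^sup>2\<close>.\<close>
      have "inj_on (\<lambda>i. (par ^^ i) v) {..2 * k}"
      proof (rule inj_onI)
        fix i j assume "i \<in> {..2 * k}" "j \<in> {..2 * k}" "(par ^^ i) v = (par ^^ j) v"
        then show "i = j"
          using climb[OF v(1), of i] climb[OF v(1), of j] False by auto
      qed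
      moreover have "finite D" "D \<subseteq> S"
        using \<open>finite S\<close> by (auto simp: D_def)
      ultimately have "card {..2 * k} \<le> card D"
        using path by (intro card_inj_on_le[of "\<lambda>i. (par ^^ i) v"]) auto
      then have "card (S - D) \<le> k\<^sup>2"
        using Suc.prems(4) \<open>finite D\<close> \<open>D \<subseteq> S\<close> by (simp add: card_Diff_subset power2_eq_square)
      \<comment> \<open>Cutting off a whole subtree leaves a tree: a child of a vertex of
        \<open>D\<close> is in \<open>D\<close>.\<close>
      moreover have "par x \<in> S - D \<and> (par x, x) \<in> parcs G \<and> d x = Suc (d (par x))"
        if x: "x \<in> S - D" "x \<noteq> r" for x
      proof -
        have p: "par x \<in> S" "(par x, x) \<in> parcs G" "d x = Suc (d (par x))"
          using Suc.prems(3) x by auto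
        moreover have "par x \<notin> D"
        proof
          assume "par x \<in> D"
          then obtain i where "i \<le> d (par x)" "(par ^^ i) (par x) = c"
            by (auto simp: D_def)
          then have "Suc i \<le> d x" "(par ^^ Suc i) x = c"
            using p(3) by (simp_all add: funpow_swap1)
          with x(1) show False by (auto simp: D_def)
        qed
        ultimately show ?thesis by blast
      qed
      moreover have "finite (S - D)" "S - D \<subseteq> pverts G"
        using Suc.prems(1,2) by auto
      ultimately obtain cs where "length cs = k" "set cs \<subseteq> pverts G" "S - D \<subseteq> covered G cs"
        using Suc.IH[of "S - D"] by blast
      then show ?thesis
        using D_ball c(1) Suc.prems(2) by (intro exI[of _ "c # cs"]) auto
    qed
  qed
qed

lemma staller_start_game_burning_number_le_sqrt:
  assumes "pair_graph G" and "Digraph_Component.connected (with_proj G)"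
    and "card (pverts G) \<le> k\<^sup>2"
  shows "staller_start_game_burning_number G \<le> 2 * k"
proof (cases "pverts G = {}")
  case True
  then show ?thesis
    unfolding staller_start_game_burning_number_def by (subst rounds_left.simps) simp
next
  case False
  interpret pair_graph G by fact
  obtain r where r: "r \<in> pverts G"
    using False by blast
  obtain d par where tree: "d r = (0::nat)"
    "\<forall>v \<in> pverts G. v \<noteq> r
      \<longrightarrow> par v \<in> pverts G \<and> (par v, v) \<in> parcs G \<and> d v = Suc (d (par v))"
    using breadth_first_tree[OF connected_spread_pow[OF assms(1,2) r] r] by metis
  have "\<exists>cs. length cs = k \<and> set cs \<subseteq> pverts G \<and> pverts G \<subseteq> covered G cs"
    by (rule covered_tree[OF pair_finite_verts order_refl r tree(1) tree(2)[rule_format] assms(3)])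
  then obtain cs where "length cs = k" "set cs \<subseteq> pverts G" "pverts G \<subseteq> covered G cs"
    by blast
  then show ?thesis
    using rounds_left_Staller_le_covered[of G cs "{}"]
    unfolding staller_start_game_burning_number_def by auto
qed

section \<open>The complement\<close>

lemma complement_complement: "pair_graph G \<Longrightarrow> complement (complement G) = G"
proof -
  assume "pair_graph G"
  then interpret pair_graph G .
  have "parcs (complement (complement G)) = parcs G"
    using arc_fst_in_verts arc_snd_in_verts pair_no_loops
    by (fastforce simp: complement_def)
  then show ?thesis
    by (simp add: complement_def)
qed

text \<open>If two adjacent vertices \<open>x\<close> and \<open>y\<close> of \<open>G\<close> had no common neighbour in the complement, then
  both \<open>u\<close> and \<open>v\<close> would be within distance one of \<open>{x, y}\<close>, hence at most \<open>3\<close> apart.\<close>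

lemma complement_spread2:
  assumes "pair_graph G" and "u \<in> pverts G" "v \<in> pverts G" and "v \<notin> (spread G ^^ 3) {u}"
    and "x \<in> pverts G"
  shows "pverts G \<subseteq> (spread (complement G) ^^ 2) {x}"
proof
  fix y assume y: "y \<in> pverts G"
  interpret pair_graph G by fact
  have sym: "(a, b) \<in> parcs G \<Longrightarrow> (b, a) \<in> parcs G" for a b
    using pair_sym_arcs by (auto simp: symmetric_def dest: symD)
  let ?N = "\<lambda>a b. a = b \<or> (a, b) \<in> parcs G"
  have walk: False if "?N u a" "?N a b" "?N b v" "a \<in> pverts G" "b \<in> pverts G" for a b
  proof -
    have "a \<in> spread G {u}"
      using that by (auto simp: spread_def)
    then have "b \<in> spread G (spread G {u})"
      using that by (auto simp: spread_def)
    then have "v \<in> spread G (spread G (spread G {u}))"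
      using that assms(3) by (auto simp: spread_def)
    then show False
      using assms(4) by (simp add: numeral_3_eq_3)
  qed
  \<comment> \<open>If \<open>?N x y\<close> fails, the complement joins \<open>x\<close> to
    \<open>y\<close> directly.\<close>
  have "\<exists>z \<in> pverts G. z \<noteq> x \<and> z \<noteq> y \<and> (x, z) \<notin> parcs G \<and> (z, y) \<notin> parcs G" if "?N x y"
  proof (rule ccontr)
    assume no: "\<not> ?thesis"
    \<comment> \<open>Otherwise \<open>u\<close> or \<open>v\<close> itself would be the required
      \<open>z\<close>.\<close>
    have "?N u x \<or> ?N u y" "?N x v \<or> ?N y v"
      using no assms(2,3) sym[of x u] sym[of v y] by metis+
    then show False
      using walk[of x x] walk[of x y] walk[of y x] walk[of y y] that sym assms(5) y by blast
  qed
  then show "y \<in> (spread (complement G) ^^ 2) {x}"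
    using y assms(5) by (auto simp: numeral_2_eq_2 spread_def complement_def)
qed

lemma burning_number_mult_le_of_far:
  assumes "pair_graph G" and "Digraph_Component.connected (with_proj G)"
    and "u \<in> pverts G" "v \<in> pverts G" "v \<notin> (spread G ^^ 3) {u}"
  shows "staller_start_game_burning_number G * staller_start_game_burning_number (complement G)
    \<le> card (pverts G) + 21"
proof -
  interpret pair_graph G by fact
  have "pverts (complement G) = pverts G"
    by (simp add: complement_def)
  then have compl: "staller_start_game_burning_number (complement G) \<le> 3"
    using staller_start_game_burning_number_le_Suc[of "complement G" 2]
      complement_spread2[OF assms(1,3-5)] by simp
  define k where "k = (LEAST k. card (pverts G) \<le> k\<^sup>2)"
  have k: "card (pverts G) \<le> k\<^sup>2"
    unfolding k_def by (rule LeastI[of _ "card (pverts G)"]) (simp add: power2_eq_square)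
  moreover have "card (pverts G) > 0"
    using assms(3) pair_finite_verts by (auto simp: card_gt_0_iff)
  ultimately obtain j where j: "k = Suc j"
    by (cases k) auto
  then have "j\<^sup>2 < card (pverts G)"
    using not_less_Least[of j "\<lambda>k. card (pverts G) \<le> k\<^sup>2"] by (simp add: k_def)
  \<comment> \<open>This gives \<open>6 * k = 6 * j + 6 \<le> j\<^sup>2 + 15\<close>, which is less
    than \<open>card (pverts G) + 15\<close>.\<close>
  moreover have "0 \<le> (int j - 3)\<^sup>2"
    by simp
  then have "6 * int j \<le> int (j\<^sup>2) + 9"
    by (simp add: power2_diff)
  ultimately have "6 * k \<le> card (pverts G) + 21"
    using j by linarith
  moreover have "staller_start_game_burning_number G * staller_start_game_burning_number (complement G)
      \<le> 2 * k * 3"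
    using staller_start_game_burning_number_le_sqrt[OF assms(1,2) k] compl by (rule mult_le_mono)
  ultimately show ?thesis by simp
qed

theorem corollary15:
  fixes G :: "'a pair_pre_digraph"
  assumes "pair_graph G"
    and "card (pverts G) \<ge> 3"
    and "Digraph_Component.connected (with_proj G)"
    and "Digraph_Component.connected (with_proj (complement G))"
  shows "staller_start_game_burning_number G * staller_start_game_burning_number (complement G)
    \<le> card (pverts G) + 21"
proof -
  let ?H = "complement G"
  have H: "pverts ?H = pverts G"
    by (simp add: complement_def)
  consider (far) u v where "u \<in> pverts G" "v \<in> pverts G" "v \<notin> (spread G ^^ 3) {u}"
    | (far_complement) u v where "u \<in> pverts ?H" "v \<in> pverts ?H" "v \<notin> (spread ?H ^^ 3) {u}"
    | (near) "\<And>u. u \<in> pverts G \<Longrightarrow> pverts G \<subseteq> (spread G ^^ 3) {u}"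
      "\<And>u. u \<in> pverts ?H \<Longrightarrow> pverts ?H \<subseteq> (spread ?H ^^ 3) {u}"
    by (meson subsetI)
  then show ?thesis
  proof cases
    case far
    then show ?thesis
      using burning_number_mult_le_of_far[OF assms(1,3)] by simp
  next
    case far_complement
    then have "staller_start_game_burning_number ?H * staller_start_game_burning_number (complement ?H)
        \<le> card (pverts ?H) + 21"
      using burning_number_mult_le_of_far[OF pair_graph_complement[OF assms(1)] assms(4)] by simp
    then show ?thesis
      by (simp add: complement_complement assms(1) H mult.commute)
  next
    case near
    \<comment> \<open>Each game lasts at most four rounds, and 16 is below 21.\<close>
    then have "staller_start_game_burning_number G * staller_start_game_burning_number ?H
        \<le> Suc 3 * Suc 3"
      by (intro mult_le_mono staller_start_game_burning_number_le_Suc)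
    then show ?thesis by simp
  qed
qed

end
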